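(* For $a>0$ let $\mathbb{H}_1^a$ be the unit ball of the RKHS of the centered Gaussian process $W^a=(W_t^a:0\le t\le1)$ with covariance kernel $G_a(t,t')=\exp\{-4a^2\sin^2(\pi t-\pi t')\}$. For $h\in\mathbb{H}_1^a$, we have $|h(0)|\le1$ and $|h(t)-h(0)|\le2\sqrt2\,\pi at$ for every $t\in[0,1]$.
   Context: RKHS means reproducing kernel Hilbert space. *)

theory Defs
  imports "HOL-Probability.Probability"
begin

(* Point masses count as normal laws (variance 0). This matters here: for the
   kernel below W 0 = W 1 almost surely, so nontrivial linear combinations of
   the process can be degenerate. *)
definition gaussian_rv :: "'w measure \<Rightarrow> ('w \<Rightarrow> real) \<Rightarrow> bool" where
  "gaussian_rv M X \<longleftrightarrow> X \<in> borel_measurable M \<and>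
     (\<exists>\<mu>. (AE w in M. X w = \<mu>) \<or>
           (\<exists>\<sigma>>0. distributed M lborel X (\<lambda>x. ennreal (normal_density \<mu> \<sigma> x))))"

definition gaussian_process :: "'w measure \<Rightarrow> 't set \<Rightarrow> ('t \<Rightarrow> 'w \<Rightarrow> real) \<Rightarrow> bool" where
  "gaussian_process M T W \<longleftrightarrow> prob_space M \<and>
     (\<forall>I c. finite I \<and> I \<subseteq> T \<longrightarrow> gaussian_rv M (\<lambda>w. \<Sum>t\<in>I. c t * W t w))"

definition centered_gaussian_process :: "'w measure \<Rightarrow> 't set \<Rightarrow> ('t \<Rightarrow> 'w \<Rightarrow> real) \<Rightarrow> bool" where
  "centered_gaussian_process M T W \<longleftrightarrow>
     gaussian_process M T W \<and> (\<forall>t\<in>T. (\<integral>w. W t w \<partial>M) = 0)"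

definition covariance_kernel :: "'w measure \<Rightarrow> ('t \<Rightarrow> 'w \<Rightarrow> real) \<Rightarrow> 't \<Rightarrow> 't \<Rightarrow> real" where
  "covariance_kernel M W s t =
     (\<integral>w. (W s w - (\<integral>v. W s v \<partial>M)) * (W t w - (\<integral>v. W t v \<partial>M)) \<partial>M)"

definition periodic_sq_exp_kernel :: "real \<Rightarrow> real \<Rightarrow> real \<Rightarrow> real" where
  "periodic_sq_exp_kernel a t t' = exp (- (4 * a\<^sup>2 * (sin (pi * t - pi * t'))\<^sup>2))"

(* A real Hilbert space H of functions on T, with inner product ip, such that
   each section of the kernel K lies in H and represents point evaluation.
   A function on T is represented by its extensional extension to the whole
   type. By the Moore-Aronszajn theorem, H, and ip on H, are determined by K
   on T, and they exist whenever K is symmetric and positive semidefinite. *)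
locale rkhs =
  fixes T :: "'t set"
    and K :: "'t \<Rightarrow> 't \<Rightarrow> real"
    and H :: "('t \<Rightarrow> real) set"
    and ip :: "('t \<Rightarrow> real) \<Rightarrow> ('t \<Rightarrow> real) \<Rightarrow> real"
  assumes extensional: "H \<subseteq> extensional T"
    and zero_mem: "(\<lambda>x\<in>T. 0) \<in> H"
    and add_mem: "f \<in> H \<Longrightarrow> g \<in> H \<Longrightarrow> (\<lambda>x\<in>T. f x + g x) \<in> H"
    and scale_mem: "f \<in> H \<Longrightarrow> (\<lambda>x\<in>T. r * f x) \<in> H"
    and ip_commute: "f \<in> H \<Longrightarrow> g \<in> H \<Longrightarrow> ip f g = ip g f"
    and ip_add_left:
      "f \<in> H \<Longrightarrow> g \<in> H \<Longrightarrow> h \<in> H \<Longrightarrow> ip (\<lambda>x\<in>T. f x + g x) h = ip f h + ip g h"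
    and ip_scale_left: "f \<in> H \<Longrightarrow> g \<in> H \<Longrightarrow> ip (\<lambda>x\<in>T. r * f x) g = r * ip f g"
    and ip_nonneg: "f \<in> H \<Longrightarrow> 0 \<le> ip f f"
    and ip_eq_zero: "f \<in> H \<Longrightarrow> ip f f = 0 \<Longrightarrow> f = (\<lambda>x\<in>T. 0)"
    and complete: "Metric_space.mcomplete H
      (\<lambda>f g. sqrt (ip (\<lambda>x\<in>T. f x - g x) (\<lambda>x\<in>T. f x - g x)))"
    and section_mem: "t \<in> T \<Longrightarrow> (\<lambda>s\<in>T. K s t) \<in> H"
    and reproducing: "h \<in> H \<Longrightarrow> t \<in> T \<Longrightarrow> ip h (\<lambda>s\<in>T. K s t) = h t"

definition unit_ball_of ::
  "('t \<Rightarrow> real) set \<Rightarrow> (('t \<Rightarrow> real) \<Rightarrow> ('t \<Rightarrow> real) \<Rightarrow> real) \<Rightarrow> ('t \<Rightarrow> real) set" where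
  "unit_ball_of H ip = {h \<in> H. sqrt (ip h h) \<le> 1}"

end

theory Submission
  imports Defs
begin

text \<open>
  By the reproducing property, a point evaluation $h(t)$ is the inner product of $h$ with the
  kernel section $K_t$, and an increment $h(t) - h(0)$ is the inner product of $h$ with
  $K_t - K_0$. Cauchy--Schwarz therefore bounds both by the norm of $h$ times the norm of the
  representing element, and the kernel determines these norms:
  $\|K_t\|^2 = K(t,t)$ and $\|K_t - K_0\|^2 = K(t,t) - 2K(t,0) + K(0,0)$
  (lemmas \<open>eval_bound\<close> and \<open>increment_bound\<close>).

  For the periodic squared exponential kernel the first quantity is $1$, and the second is
  $2(1 - e^{-4a^2\sin^2(\pi t)}) \le 8a^2\sin^2(\pi t) \le 8\pi^2a^2t^2$,
  whose square root is $2\sqrt2\,\pi a t$.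
\<close>

lemma (in rkhs) ip_add_right:
  assumes "f \<in> H" "g \<in> H" "h \<in> H"
  shows "ip h (\<lambda>x\<in>T. f x + g x) = ip h f + ip h g"
  by (simp only: assms add_mem ip_commute[of h] ip_add_left)

lemma (in rkhs) ip_scale_right:
  assumes "f \<in> H" "g \<in> H"
  shows "ip g (\<lambda>x\<in>T. r * f x) = r * ip g f"
  by (simp only: assms scale_mem ip_commute[of g] ip_scale_left)

lemma (in rkhs) ip_lincomb_right:
  assumes "f \<in> H" "g \<in> H" "h \<in> H"
  shows "(\<lambda>x\<in>T. r * f x + s * g x) \<in> H"
    and "ip h (\<lambda>x\<in>T. r * f x + s * g x) = r * ip h f + s * ip h g"
proof -
  let ?f = "\<lambda>x\<in>T. r * f x" and ?g = "\<lambda>x\<in>T. s * g x"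
  have mem: "?f \<in> H" "?g \<in> H"
    using assms scale_mem by auto
  have eq: "(\<lambda>x\<in>T. r * f x + s * g x) = (\<lambda>x\<in>T. ?f x + ?g x)"
    by auto
  show "(\<lambda>x\<in>T. r * f x + s * g x) \<in> H"
    unfolding eq using mem by (rule add_mem)
  show "ip h (\<lambda>x\<in>T. r * f x + s * g x) = r * ip h f + s * ip h g"
    unfolding eq using ip_add_right[OF mem assms(3)] ip_scale_right assms by simp
qed

lemma (in rkhs) ip_lincomb_self:
  assumes "f \<in> H" "g \<in> H"
  shows "ip (\<lambda>x\<in>T. r * f x + s * g x) (\<lambda>x\<in>T. r * f x + s * g x)
    = r\<^sup>2 * ip f f + 2 * r * s * ip f g + s\<^sup>2 * ip g g"
proof -
  let ?u = "\<lambda>x\<in>T. r * f x + s * g x"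
  have u: "?u \<in> H"
    using assms by (intro ip_lincomb_right(1))
  have "ip ?u ?u = r * ip f ?u + s * ip g ?u"
    using ip_lincomb_right(2)[OF assms u, of r s]
      ip_commute[OF u assms(1)] ip_commute[OF u assms(2)] by simp
  also have "\<dots> = r * (r * ip f f + s * ip f g) + s * (r * ip g f + s * ip g g)"
    using assms by (simp only: ip_lincomb_right(2))
  finally show ?thesis
    using ip_commute[OF assms(2,1)] by (simp add: power2_eq_square algebra_simps)
qed

lemma (in rkhs) Cauchy_Schwarz:
  assumes f: "f \<in> H" and g: "g \<in> H"
  shows "\<bar>ip f g\<bar> \<le> sqrt (ip f f) * sqrt (ip g g)"
proof -
  have "(ip f g)\<^sup>2 \<le> ip f f * ip g g"
  proof (cases "ip g g = 0")
    case True
    then have g0: "g = (\<lambda>x\<in>T. 0)"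
      by (rule ip_eq_zero[OF g])
    have "ip f g = 0"
      unfolding g0 using ip_scale_right[OF g f, of 0] by simp
    then show ?thesis
      using True by simp
  next
    case False
    then have pos: "ip g g > 0"
      using ip_nonneg[OF g] by simp
    \<comment> \<open>The combination is $\langle g,g\rangle$ times the component of $f$ orthogonal to $g$.\<close>
    let ?u = "\<lambda>x\<in>T. ip g g * f x + (- ip f g) * g x"
    have "0 \<le> ip ?u ?u"
      using f g by (intro ip_nonneg ip_lincomb_right(1))
    also have "\<dots> = ip g g * (ip f f * ip g g - (ip f g)\<^sup>2)"
      unfolding ip_lincomb_self[OF f g] by (simp add: power2_eq_square algebra_simps)
    finally show ?thesis
      using pos by (simp add: zero_le_mult_iff)
  qed
  then have "sqrt ((ip f g)\<^sup>2) \<le> sqrt (ip f f * ip g g)"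
    by (rule real_sqrt_le_mono)
  then show ?thesis
    by (simp add: real_sqrt_mult)
qed

lemma (in rkhs) ip_sections:
  assumes "s \<in> T" "t \<in> T"
  shows "ip (\<lambda>x\<in>T. K x s) (\<lambda>x\<in>T. K x t) = K t s"
  using reproducing[OF section_mem[OF assms(1)] assms(2)] assms by simp

lemma (in rkhs) eval_bound:
  assumes "h \<in> H" "t \<in> T"
  shows "\<bar>h t\<bar> \<le> sqrt (ip h h) * sqrt (K t t)"
  using Cauchy_Schwarz[OF assms(1) section_mem[OF assms(2)]] reproducing[OF assms]
    ip_sections[OF assms(2,2)] by simp

text \<open>
  The radicand is the squared norm of the difference of the two kernel sections, which represents
  the increment, so the bound is attained at that difference. If $K$ is the covariance of a
  square-integrable process, the radicand is the variance of its increment between $s$ and $t$.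
\<close>

lemma (in rkhs) increment_bound:
  assumes h: "h \<in> H" and s: "s \<in> T" and t: "t \<in> T"
  shows "\<bar>h t - h s\<bar> \<le> sqrt (ip h h) * sqrt (K t t - 2 * K s t + K s s)"
proof -
  let ?Ks = "\<lambda>x\<in>T. K x s" and ?Kt = "\<lambda>x\<in>T. K x t"
  let ?u = "\<lambda>x\<in>T. 1 * ?Kt x + (- 1) * ?Ks x"
  note mem = section_mem[OF t] section_mem[OF s]
  have "ip h ?u = h t - h s"
    unfolding ip_lincomb_right(2)[OF mem h] using reproducing[OF h] s t by simp
  moreover have "ip ?u ?u = K t t - 2 * K s t + K s s"
    unfolding ip_lincomb_self[OF mem] ip_sections[OF t t] ip_sections[OF t s]
      ip_sections[OF s s] by simp
  moreover have "?u \<in> H"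
    using mem h by (rule ip_lincomb_right(1))
  ultimately show ?thesis
    using Cauchy_Schwarz[OF h, of ?u] by simp
qed

lemma periodic_sq_exp_kernel_diag: "periodic_sq_exp_kernel a t t = 1"
  by (simp add: periodic_sq_exp_kernel_def)

lemma periodic_sq_exp_kernel_ge:
  "1 - 4 * a\<^sup>2 * pi\<^sup>2 * (s - t)\<^sup>2 \<le> periodic_sq_exp_kernel a s t"
proof -
  have "(sin (pi * s - pi * t))\<^sup>2 \<le> (pi * s - pi * t)\<^sup>2"
    by (simp flip: abs_le_square_iff add: abs_sin_x_le_abs_x)
  then have "a\<^sup>2 * (sin (pi * s - pi * t))\<^sup>2 \<le> a\<^sup>2 * (pi * s - pi * t)\<^sup>2"
    by (rule mult_left_mono) simp
  also have "\<dots> = a\<^sup>2 * pi\<^sup>2 * (s - t)\<^sup>2"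
    by (simp flip: right_diff_distrib add: power_mult_distrib)
  finally have "1 - 4 * a\<^sup>2 * pi\<^sup>2 * (s - t)\<^sup>2 \<le> 1 + - (4 * a\<^sup>2 * (sin (pi * s - pi * t))\<^sup>2)"
    by simp
  also have "\<dots> \<le> periodic_sq_exp_kernel a s t"
    unfolding periodic_sq_exp_kernel_def by (rule exp_ge_add_one_self)
  finally show ?thesis .
qed

theorem lemma4p8:
  fixes a :: real
    and M :: "'w measure"
    and W :: "real \<Rightarrow> 'w \<Rightarrow> real"
    and \<H> :: "(real \<Rightarrow> real) set"
    and ip :: "(real \<Rightarrow> real) \<Rightarrow> (real \<Rightarrow> real) \<Rightarrow> real"
    and h :: "real \<Rightarrow> real"
  assumes "a > 0"
    and "centered_gaussian_process M {0..1} W"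
    and "\<And>t t'. t \<in> {0..1} \<Longrightarrow> t' \<in> {0..1} \<Longrightarrow>
           covariance_kernel M W t t' = periodic_sq_exp_kernel a t t'"
    and "rkhs {0..1} (covariance_kernel M W) \<H> ip"
    and "h \<in> unit_ball_of \<H> ip"
  shows "\<bar>h 0\<bar> \<le> 1 \<and> (\<forall>t\<in>{0..1}. \<bar>h t - h 0\<bar> \<le> 2 * sqrt 2 * pi * a * t)"
proof -
  interpret rkhs "{0..1}" "covariance_kernel M W" \<H> ip
    by fact
  note K = assms(3)
  have h: "h \<in> \<H>" and norm_h: "sqrt (ip h h) \<le> 1"
    using assms(5) by (auto simp: unit_ball_of_def)
  have "\<bar>h 0\<bar> \<le> 1"
    using eval_bound[OF h, of 0] norm_h by (auto simp: K periodic_sq_exp_kernel_diag intro: order_trans)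
  moreover have "\<bar>h t - h 0\<bar> \<le> 2 * sqrt 2 * pi * a * t" if t: "t \<in> {0..1}" for t
  proof -
    let ?V = "2 - 2 * periodic_sq_exp_kernel a 0 t"
    have "?V \<le> (2 * sqrt 2 * pi * a * t)\<^sup>2"
      using periodic_sq_exp_kernel_ge[of a 0 t]
      by (simp add: power_mult_distrib algebra_simps)
    then have V: "sqrt ?V \<le> 2 * sqrt 2 * pi * a * t"
      using assms(1) t by (intro real_le_lsqrt) auto
    have "0 \<le> ?V"
      by (simp add: periodic_sq_exp_kernel_def)
    have "\<bar>h t - h 0\<bar> \<le> sqrt (ip h h) * sqrt ?V"
      using increment_bound[OF h, of 0 t] t by (simp add: K periodic_sq_exp_kernel_diag)
    also have "\<dots> \<le> 1 * sqrt ?V"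
      using norm_h \<open>0 \<le> ?V\<close> by (intro mult_right_mono) auto
    finally show ?thesis
      using V by simp
  qed
  ultimately show ?thesis
    by blast
qed

end
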